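(* Let $\ell\ge 1$ and $n\ge 0$ be integers. If $\binom{\ell}{4}+3<2^n$, then there exists a no-quads set of $\ell$ cards in the EvenQuads-$2^n$ deck.
   Context: The EvenQuads-$2^n$ deck is the set $\mathbb{Z}_2^n$, whose elements are called cards. A quad is a set of four distinct cards $\vec a,\vec b,\vec c,\vec d$ with $\vec a+\vec b+\vec c+\vec d=\vec 0$. A no-quads set is a set of distinct cards containing no quad. *)

theory Defs
  imports "HOL-Library.Z2" "Jordan_Normal_Form.Matrix"
begin

(* Type bit is the field with two elements, so carrier_vec n is Z_2^n, including n = 0;
   the dimension is a term, and addition is componentwise modulo 2. *)
definition deck :: "nat \<Rightarrow> bit vec set" where
  "deck n = carrier_vec n"

definition is_quad :: "nat \<Rightarrow> bit vec set \<Rightarrow> bool" where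
  "is_quad n Q \<longleftrightarrow> Q \<subseteq> deck n \<and>
     (\<exists>a b c d. Q = {a, b, c, d} \<and> distinct [a, b, c, d] \<and> a + b + c + d = 0\<^sub>v n)"

definition no_quads :: "nat \<Rightarrow> bit vec set \<Rightarrow> bool" where
  "no_quads n S \<longleftrightarrow> S \<subseteq> deck n \<and> \<not> (\<exists>Q. is_quad n Q \<and> Q \<subseteq> S)"

end

theory Submission
  imports Defs
begin

text \<open>Cards are added greedily: a new card keeps a set of \<open>m\<close> cards free of quads as soon as it
  avoids these cards and the sums of three of them, which excludes at most
  \<open>(m choose 3) + m \<le> (Suc m choose 4) + 3\<close> cards.\<close>

text \<open>Vectors of dimension \<open>n\<close> correspond to lists of length \<open>n\<close>
  over the scalars, and these are counted by \<open>card_lists_length_eq\<close>.\<close>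

lemma card_carrier_vec:
  assumes "finite (UNIV :: 'a set)"
  shows "card (carrier_vec n :: 'a vec set) = card (UNIV :: 'a set) ^ n"
proof -
  have "bij_betw list_of_vec (carrier_vec n :: 'a vec set) {xs. set xs \<subseteq> UNIV \<and> length xs = n}"
    by (rule bij_betw_byWitness[where f' = vec_of_list])
       (auto simp: vec_list list_vec intro!: carrier_vecI)
  then show ?thesis
    using card_lists_length_eq[OF assms, of n] by (simp add: bij_betw_same_card)
qed

lemma card_deck: "card (deck n) = 2 ^ n"
proof -
  have UNIV_bit: "(UNIV :: bit set) = {0, 1}"
    using bit.exhaust by auto
  have "finite (UNIV :: bit set)" "card (UNIV :: bit set) = 2"
    unfolding UNIV_bit by simp_all
  then show ?thesis
    by (simp add: deck_def card_carrier_vec)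
qed

lemma finite_no_quads: "no_quads n S \<Longrightarrow> finite S"
proof -
  have "finite (deck n)"
    \<comment> \<open>\<open>card\<close> is 0 on infinite sets, so the positive value
      \<open>2 ^ n\<close> forces finiteness.\<close>
    by (intro card_ge_0_finite) (simp add: card_deck)
  then show "no_quads n S \<Longrightarrow> finite S"
    by (auto simp: no_quads_def intro: finite_subset)
qed

text \<open>Pascal's rule reduces this to \<open>m \<le> (m choose 4) + 3\<close>. The constant 3
  covers \<open>m \<le> 3\<close>; from there on each step raises \<open>m choose 4\<close> by
  \<open>m choose 3\<close>, which is at least 1.\<close>

lemma choose_three_add_le: "(m choose 3) + m \<le> (Suc m choose 4) + 3"
proof -
  have "m \<le> (m choose 4) + 3"
  proof (induction m)
    case (Suc m)
    show ?case
    proof (cases "m < 3")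
      case False
      then have "0 < m choose 3"
        by simp
      moreover have "Suc m choose 4 = (m choose 3) + (m choose 4)"
        by (simp add: eval_nat_numeral)
      ultimately show ?thesis
        using Suc by linarith
    qed simp
  qed simp
  then show ?thesis
    by (simp add: eval_nat_numeral)
qed

text \<open>The zero vector depends on \<open>n\<close>, so the sum over a set is formed in each
  coordinate, where the scalars supply the zero.\<close>

definition vec_sum :: "nat \<Rightarrow> bit vec set \<Rightarrow> bit vec" where
  "vec_sum n T = vec n (\<lambda>i. \<Sum>v\<in>T. v $ i)"

text \<open>In characteristic 2 every element is its own negative, so a vanishing sum of four cards
  expresses each of them through the other three.\<close>

lemma quad_imp_vec_sum:
  assumes Q: "is_quad n Q" and x: "x \<in> Q"
  shows "card (Q - {x}) = 3" and "x = vec_sum n (Q - {x})"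
proof -
  from Q obtain a b c d where Q_eq: "Q = {a, b, c, d}" and dist: "distinct [a, b, c, d]"
    and sum0: "a + b + c + d = 0\<^sub>v n" and sub: "Q \<subseteq> carrier_vec n"
    by (auto simp: is_quad_def deck_def)
  have fin: "finite Q" and "card Q = 4"
    using dist by (simp_all add: Q_eq)
  then show "card (Q - {x}) = 3"
    using x by simp
  show "x = vec_sum n (Q - {x})"
  proof (rule eq_vecI)
    fix i assume "i < dim_vec (vec_sum n (Q - {x}))"
    then have i: "i < n"
      by (simp add: vec_sum_def)
    have dims: "dim_vec a = n" "dim_vec b = n" "dim_vec c = n" "dim_vec d = n"
      using sub by (auto simp: Q_eq)
    \<comment> \<open>Distinctness makes the sum over the set \<open>Q\<close> have exactly four
      summands.\<close>
    have "(\<Sum>v\<in>Q. v $ i) = (a + b + c + d) $ i"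
      using dist i dims
      by (cases "a $ i"; cases "b $ i"; cases "c $ i"; cases "d $ i") (simp_all add: Q_eq)
    also have "\<dots> = 0"
      using sum0 i by simp
    finally have "x $ i + (\<Sum>v\<in>Q - {x}. v $ i) = 0"
      using sum.remove[OF fin x, of "\<lambda>v. v $ i"] by simp
    then have "x $ i = (\<Sum>v\<in>Q - {x}. v $ i)"
      by (cases "x $ i"; cases "\<Sum>v\<in>Q - {x}. v $ i") auto
    then show "x $ i = vec_sum n (Q - {x}) $ i"
      using i by (simp add: vec_sum_def)
  qed (use sub x in \<open>auto simp: vec_sum_def\<close>)
qed

text \<open>A quad in \<open>insert x S\<close> must contain \<open>x\<close>, as \<open>S\<close>
  has none; its other three cards then lie in \<open>S\<close> and sum to \<open>x\<close>.\<close>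

lemma no_quads_insert:
  assumes S: "no_quads n S" and x: "x \<in> deck n"
    and new: "x \<notin> vec_sum n ` {T. T \<subseteq> S \<and> card T = 3}"
  shows "no_quads n (insert x S)"
proof -
  have False if Q: "is_quad n Q" "Q \<subseteq> insert x S" for Q
  proof (cases "x \<in> Q")
    case True
    then show False
      using quad_imp_vec_sum[OF Q(1) True] Q(2) new by blast
  next
    case False
    then show False
      using S Q by (auto simp: no_quads_def)
  qed
  then show ?thesis
    using S x by (auto simp: no_quads_def)
qed

lemma no_quads_extend:
  assumes S: "no_quads n S" and less: "(card S choose 3) + card S < 2 ^ n"
  obtains x where "x \<notin> S" "no_quads n (insert x S)"
proof -
  let ?D = "vec_sum n ` {T. T \<subseteq> S \<and> card T = 3}"
  have fin: "finite S"
    using S by (rule finite_no_quads)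
  \<comment> \<open>\<open>S\<close> is excluded along with \<open>?D\<close> so that the new card
    really enlarges the set.\<close>
  have "card (?D \<union> S) \<le> card ?D + card S"
    by (rule card_Un_le)
  also have "card ?D \<le> card S choose 3"
    using card_image_le[of "{T. T \<subseteq> S \<and> card T = 3}" "vec_sum n"] fin
    by (simp add: n_subsets)
  finally have "card (?D \<union> S) < card (deck n)"
    using less by (simp add: card_deck)
  then have "\<not> deck n \<subseteq> ?D \<union> S"
    using card_mono[of "?D \<union> S" "deck n"] fin by auto
  then show thesis
    using that no_quads_insert[OF S] by blast
qed

theorem theorem11:
  fixes l n :: nat
  assumes "l \<ge> 1" and "(l choose 4) + 3 < 2 ^ n"
  shows "\<exists>S. no_quads n S \<and> card S = l"
  using assms(2)
proof (induction l)
  case 0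
  have "no_quads n {}"
    by (auto simp: no_quads_def is_quad_def)
  then show ?case
    by (intro exI[of _ "{}"]) simp
next
  case (Suc l)
  \<comment> \<open>Monotonicity passes the bound for \<open>Suc l\<close> down to \<open>l\<close>,
    as the induction hypothesis requires.\<close>
  have "l choose 4 \<le> Suc l choose 4"
    by (rule binomial_right_mono) simp
  then obtain S where S: "no_quads n S" "card S = l"
    using Suc by auto
  moreover have "(l choose 3) + l < 2 ^ n"
    using choose_three_add_le[of l] Suc.prems by simp
  ultimately obtain x where "x \<notin> S" "no_quads n (insert x S)"
    using no_quads_extend by metis
  moreover have "finite S"
    using S(1) by (rule finite_no_quads)
  ultimately show ?case
    using S by (intro exI[of _ "insert x S"]) simp
qed

end
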